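(* Let $X\neq\{0\}$ be a real Banach space with dual $X^*$. If $A:X\to X^*$ is a positive semidefinite and invertible linear operator, then $A$ is coercive (in particular, $A$ is positive definite). In fact, $$\langle Ax,x\rangle\geq \|A^{-1}\|^{-1}\|x\|^2\quad\text{for all } x\in X,$$ and $\|A^{-1}\|^{-1}$ is the optimal (largest possible) coercivity coefficient, i.e. the largest $\beta>0$ such that $\langle Ax,x\rangle\geq\beta\|x\|^2$ for all $x\in X$.
   Context: For $x^*\in X^*$ and $x\in X$ one writes $\langle x^*,x\rangle:=x^*(x)=:\langle x,x^*\rangle$. An operator $A:X\to X^*$ is called an invertible positive semidefinite linear operator if it is linear, continuous, invertible, symmetric (that is, $\langle Ax,y\rangle=\langle x,Ay\rangle$ for all $x,y\in X$), and satisfies $\langle Ax,x\rangle\geq 0$ for all $x\in X$. It is positive definite if, in addition, $\langle Ax,x\rangle>0$ for all $0\neq x\in X$. $A$ is coercive if there is $\beta>0$ (a coercivity coefficient) such that $\langle Ax,x\rangle\geq\beta\|x\|^2$ for all $x\in X$. $\|A^{-1}\|$ is the operator norm of $A^{-1}:X^*\to X$. *)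

theory Defs
  imports "HOL-Analysis.Bounded_Linear_Function"
begin

text \<open>
  The dual of \<open>'a\<close> is the space \<open>'a \<Rightarrow>\<^sub>L real\<close> of bounded linear functionals with the
  operator norm, so \<open>A x y\<close> is the duality pairing of \<open>A x\<close> with \<open>y\<close>. Linearity and
  continuity of \<open>A\<close> are built into its type.

  Invertibility is bijectivity only: boundedness of the inverse is not assumed, since it
  follows from the open mapping theorem when \<open>'a\<close> is a Banach space.
\<close>

definition invertible_pos_semidef ::
  "('a::real_normed_vector \<Rightarrow>\<^sub>L ('a \<Rightarrow>\<^sub>L real)) \<Rightarrow> bool" where
  "invertible_pos_semidef A \<longleftrightarrow>
     bij (blinfun_apply A) \<and> (\<forall>x y. A x y = A y x) \<and> (\<forall>x. A x x \<ge> 0)"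

definition invertible_pos_def ::
  "('a::real_normed_vector \<Rightarrow>\<^sub>L ('a \<Rightarrow>\<^sub>L real)) \<Rightarrow> bool" where
  "invertible_pos_def A \<longleftrightarrow> invertible_pos_semidef A \<and> (\<forall>x. x \<noteq> 0 \<longrightarrow> A x x > 0)"

definition coercivity_coefficient ::
  "('a::real_normed_vector \<Rightarrow>\<^sub>L ('a \<Rightarrow>\<^sub>L real)) \<Rightarrow> real \<Rightarrow> bool" where
  "coercivity_coefficient A \<beta> \<longleftrightarrow> \<beta> > 0 \<and> (\<forall>x. A x x \<ge> \<beta> * (norm x)\<^sup>2)"

definition coercive ::
  "('a::real_normed_vector \<Rightarrow>\<^sub>L ('a \<Rightarrow>\<^sub>L real)) \<Rightarrow> bool" where
  "coercive A \<longleftrightarrow> (\<exists>\<beta>. coercivity_coefficient A \<beta>)"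

end

theory Submission
  imports Defs "HOL-Analysis.Urysohn"
begin

text \<open>
  The inverse of \<open>A\<close> is bounded by the open mapping theorem, proved here in the quantitative
  form \<open>open_mapping_preimage_bound\<close>; hence \<open>norm x \<le> c * norm (A x)\<close> with \<open>c\<close> the operator
  norm of the inverse.

  The sharp constant is then found by a variational argument on the unit sphere. Let \<open>\<beta>\<close> be
  the infimum of \<open>A x x\<close> over unit vectors. If a unit vector \<open>x\<close> attained it, then comparing \<open>A x x = \<beta>\<close> with
  \<open>A (x - t z) (x - t z) \<ge> \<beta> (1 - t)\<^sup>2\<close> to first order in \<open>t\<close> would give \<open>A x z \<le> \<beta>\<close> for all
  unit vectors \<open>z\<close>, that is \<open>norm (A x) \<le> \<beta>\<close>, and so \<open>1 = norm x \<le> c * \<beta>\<close>. The infimum need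
  not be attained, but an almost minimal \<open>x\<close> satisfies \<open>norm (A x) \<le> \<beta> + O(t)\<close>
  (\<open>near_minimizer_norm_le\<close>), and \<open>t\<close> may be sent to \<open>0\<close>. Thus \<open>\<beta> \<ge> 1 / c\<close>, which is the
  asserted coercivity.

  Optimality is the easy direction: a coercivity coefficient \<open>\<beta>\<close> forces
  \<open>\<beta> * (norm x)\<^sup>2 \<le> A x x \<le> norm (A x) * norm x\<close>, so the inverse has norm at most \<open>1 / \<beta>\<close>.
\<close>

text \<open>
  Baire's theorem gives a ball inside the closure of the image of some ball. Its centre is
  removed by subtracting two approximations, and linearity scales the result to all of the
  target space.
\<close>

lemma surj_approximate_preimage_bound:
  fixes f :: "'a::real_normed_vector \<Rightarrow> 'b::banach"
  assumes f: "bounded_linear f" and surj: "surj f"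
  obtains C where "C > 0"
    and "\<And>y e. e > 0 \<Longrightarrow> \<exists>x. norm x \<le> C * norm y \<and> norm (y - f x) < e"
proof -
  interpret f: bounded_linear f by fact
  let ?K = "\<lambda>n::nat. closure (f ` cball 0 (real n))"
  have union: "\<Union>(range ?K) = UNIV"
  proof -
    have "y \<in> \<Union>(range ?K)" for y
    proof -
      obtain x where x: "y = f x" using surj by (rule surjE)
      obtain n :: nat where "norm x \<le> real n" using real_arch_simple by blast
      then have "y \<in> f ` cball 0 (real n)" unfolding x by (intro imageI) simp
      then have "y \<in> ?K n" by (rule subsetD[OF closure_subset])
      then show ?thesis by (rule UN_I[OF UNIV_I])
    qed
    then show ?thesis by blast
  qed
  have "\<exists>n. interior (?K n) \<noteq> {}"
  proof (rule ccontr)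
    assume "\<not> ?thesis"
    then have "euclidean interior_of (\<Union>(range ?K)) = {}"
      by (intro Baire_category_alt)
        (auto simp: completely_metrizable_space_euclidean)
    then show False by (simp add: union)
  qed
  then obtain n y0 where "y0 \<in> interior (?K n)" by blast
  then obtain r where r: "r > 0" "ball y0 r \<subseteq> ?K n"
    using mem_interior by blast
  have small: "\<exists>x. norm x \<le> 2 * real n \<and> norm (y - f x) < e"
    if y: "norm y < r" and e: "e > 0" for y e
  proof -
    have approachable: "\<exists>a. norm a \<le> real n \<and> norm (f a - w) < e/2" if "w \<in> ball y0 r" for w
    proof -
      have "w \<in> ?K n" using r(2) that by (rule subsetD)
      then have "\<exists>v\<in>f ` cball 0 (real n). dist v w < e/2"
        using half_gt_zero[OF e] unfolding closure_approachable by blast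
      then show ?thesis unfolding dist_norm by force
    qed
    obtain a b where ab: "norm a \<le> real n" "norm (f a - (y0 + y)) < e/2"
        "norm b \<le> real n" "norm (f b - y0) < e/2"
      using approachable[of "y0 + y"] approachable[of y0] r(1) y
      by (auto simp: dist_norm)
    have eq: "y - f (a - b) = (f b - y0) - (f a - (y0 + y))"
      by (simp add: f.diff)
    have "norm (y - f (a - b)) < e"
      unfolding eq using norm_triangle_ineq4[of "f b - y0" "f a - (y0 + y)"] ab(2,4) by linarith
    moreover have "norm (a - b) \<le> 2 * real n"
      using norm_triangle_ineq4[of a b] ab by simp
    ultimately show ?thesis by blast
  qed
  \<comment> \<open>Scaling to norm \<open>r / 2\<close> stays strictly inside the ball; the summand \<open>1\<close> makes \<open>C\<close> positive
    even for \<open>n = 0\<close>.\<close>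
  define C where "C = 2 * (2 * real n + 1) / r"
  show thesis
  proof
    show "C > 0" using r by (simp add: C_def)
    fix y :: 'b and e :: real
    assume e: "e > 0"
    show "\<exists>x. norm x \<le> C * norm y \<and> norm (y - f x) < e"
    proof (cases "y = 0")
      case True
      then show ?thesis using e by (intro exI[of _ 0]) (simp add: f.zero)
    next
      case False
      define s where "s = r / (2 * norm y)"
      have s: "s > 0" using False r by (simp add: s_def)
      have "norm (s *\<^sub>R y) < r" using False r by (simp add: s_def)
      then obtain x where x: "norm x \<le> 2 * real n" "norm (s *\<^sub>R y - f x) < s * e"
        using small[of "s *\<^sub>R y" "s * e"] s e by auto
      have "s *\<^sub>R y - f x = s *\<^sub>R (y - f (x /\<^sub>R s))"
        using s by (simp add: f.scaleR algebra_simps)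
      then have "s * norm (y - f (x /\<^sub>R s)) < s * e"
        using x(2) s by simp
      then have "norm (y - f (x /\<^sub>R s)) < e" using s by simp
      moreover have "norm (x /\<^sub>R s) \<le> C * norm y"
      proof -
        have "norm (x /\<^sub>R s) = norm x / s" using s by (simp add: field_simps)
        also have "\<dots> \<le> (2 * real n + 1) / s"
          using x(1) s by (intro divide_right_mono) auto
        also have "\<dots> = C * norm y"
          using False r by (simp add: C_def s_def)
        finally show ?thesis .
      qed
      ultimately show ?thesis by blast
    qed
  qed
qed

text \<open>
  Exact preimages arise by iterating the approximation: each step halves the residual, so the
  corrections form a geometrically dominated series. Completeness of the domain makes it
  converge.
\<close>

lemma open_mapping_preimage_bound:
  fixes f :: "'a::banach \<Rightarrow> 'b::banach"
  assumes f: "bounded_linear f" and surj: "surj f"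
  obtains C where "\<And>y. \<exists>x. f x = y \<and> norm x \<le> C * norm y"
proof -
  interpret f: bounded_linear f by fact
  obtain C where C: "C > 0"
    and appr: "\<And>y e. e > 0 \<Longrightarrow> \<exists>x. norm x \<le> C * norm y \<and> norm (y - f x) < e"
    using surj_approximate_preimage_bound[OF f surj] by blast
  have "\<exists>x. norm x \<le> C * norm y \<and> norm (y - f x) \<le> norm y / 2" for y
  proof (cases "y = 0")
    case True
    then show ?thesis by (intro exI[of _ 0]) (simp add: f.zero)
  next
    case False
    then show ?thesis using appr[of "norm y / 2" y] by force
  qed
  then obtain g where g: "\<And>y. norm (g y) \<le> C * norm y"
      "\<And>y. norm (y - f (g y)) \<le> norm y / 2"
    by metis
  show thesis
  proof
    fix y
    define z where "z k = ((\<lambda>w. w - f (g w)) ^^ k) y" for k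
    have z0: "z 0 = y" and zS: "z (Suc k) = z k - f (g (z k))" for k
      by (simp_all add: z_def)
    have z_le: "norm (z k) \<le> norm y * (1/2) ^ k" for k
    proof (induction k)
      case (Suc k)
      then show ?case using g(2)[of "z k"] by (simp add: zS)
    qed (simp add: z0)
    have "(\<lambda>k. norm y * (1/2) ^ k) \<longlonglongrightarrow> norm y * 0"
      by (intro tendsto_intros LIMSEQ_power_zero) simp
    then have z_lim: "z \<longlonglongrightarrow> 0"
      using z_le by (intro Lim_null_comparison[of z "\<lambda>k. norm y * (1/2) ^ k"]) auto
    have g_le: "norm (g (z k)) \<le> C * norm y * (1/2) ^ k" for k
      using g(1)[of "z k"] mult_left_mono[OF z_le[of k], of C] C
      unfolding mult.assoc by linarith
    have geo: "(\<lambda>k. C * norm y * (1/2) ^ k) sums (C * norm y * 2)"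
      using sums_mult[OF geometric_sums[of "1/2::real"], of "C * norm y"] by simp
    have sum: "summable (\<lambda>k. g (z k))"
      using sums_summable[OF geo] g_le by (rule summable_comparison_test'[where N = 0])
    have "(\<lambda>k. f (g (z k))) sums f (\<Sum>k. g (z k))"
      using sum by (intro f.sums summable_sums)
    moreover have "(\<lambda>k. f (g (z k))) sums y"
      using telescope_sums'[OF z_lim] by (simp add: zS z0)
    ultimately have "f (\<Sum>k. g (z k)) = y" by (rule sums_unique2)
    moreover have "norm (\<Sum>k. g (z k)) \<le> (2 * C) * norm y"
    proof -
      have "norm (\<Sum>k. g (z k)) \<le> (\<Sum>k. C * norm y * (1/2) ^ k)"
        using g_le sums_summable[OF geo] by (intro norm_suminf_le)
      then show ?thesis using sums_unique[OF geo] by simp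
    qed
    ultimately show "\<exists>x. f x = y \<and> norm x \<le> (2 * C) * norm y" by blast
  qed
qed

lemma bounded_linear_inv_banach:
  fixes f :: "'a::banach \<Rightarrow> 'b::banach"
  assumes f: "bounded_linear f" and bij: "bij f"
  shows "bounded_linear (inv f)"
proof -
  interpret f: bounded_linear f by fact
  have inv_eq: "inv f y = x" if "f x = y" for x y
    using bij that by (metis bij_inv_eq_iff)
  have f_inv: "f (inv f y) = y" for y
    using bij by (simp add: bij_is_surj surj_f_inv_f)
  obtain C where C: "\<And>y. \<exists>x. f x = y \<and> norm x \<le> C * norm y"
    using open_mapping_preimage_bound[OF f bij_is_surj[OF bij]] by blast
  show ?thesis
  proof (rule bounded_linear_intro[where K = C])
    show "inv f (x + y) = inv f x + inv f y" for x y
      by (rule inv_eq) (simp add: f.add f_inv)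
    show "inv f (r *\<^sub>R x) = r *\<^sub>R inv f x" for r x
      by (rule inv_eq) (simp add: f.scaleR f_inv)
    show "norm (inv f y) \<le> norm y * C" for y
      using C[of y] inv_eq by (metis mult.commute)
  qed
qed

text \<open>
  For a unit vector \<open>x\<close> that minimizes the quadratic form on the sphere up to \<open>t\<^sup>2\<close>, testing the
  lower bound at \<open>x - t z\<close> controls the first-order term \<open>A x z\<close>. Balancing the defect \<open>t\<^sup>2\<close>
  against the step size \<open>t\<close> leaves an error of order \<open>t\<close>.
\<close>

lemma near_minimizer_norm_le:
  fixes A :: "'a::real_normed_vector \<Rightarrow>\<^sub>L ('a \<Rightarrow>\<^sub>L real)"
  assumes sym: "\<And>x y. A x y = A y x"
    and lower: "\<And>y. \<beta> * (norm y)\<^sup>2 \<le> A y y" and "0 \<le> \<beta>"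
    and x: "norm x = 1" "A x x \<le> \<beta> + t\<^sup>2" and t: "0 < t" "t < 1"
  shows "norm (A x) \<le> \<beta> + t * (1 + norm A) / 2"
proof -
  let ?b = "\<beta> + t * (1 + norm A) / 2"
  have b0: "0 \<le> ?b" using \<open>0 \<le> \<beta>\<close> t by simp
  have unit: "A x z \<le> ?b" if z: "norm z = 1" for z
  proof -
    have "1 - t \<le> norm (x - t *\<^sub>R z)"
      using norm_triangle_ineq2[of x "t *\<^sub>R z"] x z t by simp
    then have "\<beta> * (1 - t)\<^sup>2 \<le> \<beta> * (norm (x - t *\<^sub>R z))\<^sup>2"
      using t \<open>0 \<le> \<beta>\<close> by (intro mult_left_mono power_mono) auto
    also have "\<dots> \<le> A (x - t *\<^sub>R z) (x - t *\<^sub>R z)" by (rule lower)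
    also have "\<dots> = A x x - 2 * t * A x z + t\<^sup>2 * A z z"
      by (simp add: blinfun.diff_left blinfun.diff_right blinfun.scaleR_left
          blinfun.scaleR_right sym[of z x] power2_eq_square algebra_simps)
    also have "\<dots> \<le> (\<beta> + t\<^sup>2) - 2 * t * A x z + t\<^sup>2 * norm A"
    proof -
      have "A z z \<le> norm (A z) * norm z" using norm_blinfun[of "A z" z] by simp
      also have "\<dots> \<le> norm A" using norm_blinfun[of A z] z by simp
      finally have "t\<^sup>2 * A z z \<le> t\<^sup>2 * norm A" by (intro mult_left_mono) auto
      then show ?thesis using x(2) by linarith
    qed
    finally have "2 * t * A x z \<le> 2 * t * \<beta> - \<beta> * t\<^sup>2 + t\<^sup>2 + t\<^sup>2 * norm A"
      by (simp add: power2_eq_square algebra_simps)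
    also have "\<dots> \<le> 2 * t * \<beta> + t\<^sup>2 + t\<^sup>2 * norm A"
      using \<open>0 \<le> \<beta>\<close> by simp
    also have "\<dots> = 2 * t * ?b" by (simp add: power2_eq_square algebra_simps)
    finally show ?thesis using t by simp
  qed
  have le: "A x z \<le> ?b * norm z" for z
  proof (cases "z = 0")
    case False
    then have "A x (z /\<^sub>R norm z) \<le> ?b" by (intro unit) simp
    then show ?thesis using False by (simp add: blinfun.scaleR_right field_simps)
  qed simp
  show ?thesis
  proof (rule norm_blinfun_bound[OF b0])
    show "norm (A x z) \<le> ?b * norm z" for z
      using le[of z] le[of "- z"] by (simp add: blinfun.minus_right abs_le_iff)
  qed
qed

text \<open>
  The best coercivity constant is the infimum of the form over the unit sphere. Almost minimal
  unit vectors have images of norm close to that infimum, so a lower bound \<open>1 / c\<close> for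
  \<open>norm (A u)\<close> on the sphere is inherited by the infimum.
\<close>

lemma coercive_of_bounded_below:
  fixes A :: "'a::real_normed_vector \<Rightarrow>\<^sub>L ('a \<Rightarrow>\<^sub>L real)"
  assumes sym: "\<And>x y. A x y = A y x" and pos: "\<And>x. 0 \<le> A x x"
    and below: "\<And>x. norm x \<le> c * norm (A x)" and "c > 0"
  shows "inverse c * (norm x)\<^sup>2 \<le> A x x"
proof (cases "x = 0")
  case False
  let ?Q = "(\<lambda>u. A u u) ` sphere 0 1"
  define \<beta> where "\<beta> = Inf ?Q"
  have "x /\<^sub>R norm x \<in> sphere 0 1" using False by simp
  then have ne: "?Q \<noteq> {}" by blast
  have bdd: "bdd_below ?Q" using pos by (auto intro!: bdd_belowI[of _ 0])
  have \<beta>0: "0 \<le> \<beta>" unfolding \<beta>_def using ne pos by (intro cInf_greatest) auto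
  have lower: "\<beta> * (norm y)\<^sup>2 \<le> A y y" for y
  proof (cases "y = 0")
    case False
    then have "\<beta> \<le> A (y /\<^sub>R norm y) (y /\<^sub>R norm y)"
      unfolding \<beta>_def by (intro cInf_lower bdd imageI) simp
    also have "\<dots> = A y y / (norm y)\<^sup>2"
      by (simp add: blinfun.scaleR_left blinfun.scaleR_right power2_eq_square field_simps)
    finally show ?thesis using False by (simp add: field_simps)
  qed simp
  have approx: "1 \<le> c * (\<beta> + t * (1 + norm A) / 2)" if t: "0 < t" "t < 1" for t
  proof -
    have "\<exists>q\<in>?Q. q < \<beta> + t\<^sup>2"
      using cInf_less_iff[OF ne bdd, of "\<beta> + t\<^sup>2"] t by (simp add: \<beta>_def)
    then obtain u where u: "norm u = 1" "A u u \<le> \<beta> + t\<^sup>2" by force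
    have "1 \<le> c * norm (A u)" using below[of u] u by simp
    also have "\<dots> \<le> c * (\<beta> + t * (1 + norm A) / 2)"
      using near_minimizer_norm_le[OF sym lower \<beta>0 u t] \<open>c > 0\<close> by simp
    finally show ?thesis .
  qed
  have "((\<lambda>t. c * (\<beta> + t * (1 + norm A) / 2)) \<longlongrightarrow> c * (\<beta> + 0 * (1 + norm A) / 2)) (at_right 0)"
    by (intro tendsto_intros) auto
  moreover have "\<forall>\<^sub>F t in at_right 0. 1 \<le> c * (\<beta> + t * (1 + norm A) / 2)"
    using approx by (auto simp: eventually_at_right[of 0 1] intro!: exI[of _ 1])
  ultimately have "1 \<le> c * \<beta>"
    using tendsto_lowerbound[of _ _ "at_right (0::real)" 1] by force
  then have "inverse c \<le> \<beta>" using \<open>c > 0\<close> by (simp add: field_simps)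
  then have "inverse c * (norm x)\<^sup>2 \<le> \<beta> * (norm x)\<^sup>2" by (intro mult_right_mono) auto
  then show ?thesis using lower[of x] by linarith
qed simp

lemma coercivity_coefficient_imp_bounded_below:
  assumes "coercivity_coefficient A \<beta>"
  shows "\<beta> * norm x \<le> norm (A x)"
proof (cases "x = 0")
  case False
  have "\<beta> * (norm x)\<^sup>2 \<le> A x x"
    using assms by (simp add: coercivity_coefficient_def)
  also have "\<dots> \<le> norm (A x) * norm x"
    using norm_blinfun[of "A x" x] by simp
  finally show ?thesis using False by (simp add: power2_eq_square)
qed simp

theorem lemma11p2:
  fixes A :: "'a::banach \<Rightarrow>\<^sub>L ('a \<Rightarrow>\<^sub>L real)"
  assumes "(UNIV :: 'a set) \<noteq> {0}"
    and "invertible_pos_semidef A"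
  shows "coercive A \<and>
     invertible_pos_def A \<and>
     (\<forall>x. A x x \<ge> inverse (onorm (inv (blinfun_apply A))) * (norm x)\<^sup>2) \<and>
     coercivity_coefficient A (inverse (onorm (inv (blinfun_apply A)))) \<and>
     (\<forall>\<beta>. coercivity_coefficient A \<beta> \<longrightarrow> \<beta> \<le> inverse (onorm (inv (blinfun_apply A))))"
proof -
  let ?B = "inv (blinfun_apply A)"
  let ?c = "onorm ?B"
  have bij: "bij (blinfun_apply A)" and sym: "A x y = A y x" and pos: "0 \<le> A x x" for x y
    using assms(2) by (auto simp: invertible_pos_semidef_def)
  have BA: "?B (A x) = x" for x using bij by (simp add: bij_is_inj)
  have AB: "A (?B y) = y" for y using bij by (simp add: bij_is_surj surj_f_inv_f)
  have B: "bounded_linear ?B"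
    by (rule bounded_linear_inv_banach[OF blinfun.bounded_linear_right bij])
  obtain a :: 'a where "a \<noteq> 0" using assms(1) by blast
  then have c0: "0 < ?c" using onorm_pos_lt[OF B] BA by metis
  have lower: "inverse ?c * (norm x)\<^sup>2 \<le> A x x" for x
    using coercive_of_bounded_below[OF sym pos _ c0] onorm[OF B] BA by metis
  have coeff: "coercivity_coefficient A (inverse ?c)"
    using lower c0 by (simp add: coercivity_coefficient_def)
  have "A x x > 0" if "x \<noteq> 0" for x
  proof -
    have "0 < inverse ?c * (norm x)\<^sup>2" using c0 that by simp
    then show ?thesis using lower[of x] by linarith
  qed
  then have "invertible_pos_def A" using assms(2) by (simp add: invertible_pos_def_def)
  moreover have "\<beta> \<le> inverse ?c" if \<beta>: "coercivity_coefficient A \<beta>" for \<beta>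
  proof -
    have \<beta>0: "\<beta> > 0" using \<beta> by (simp add: coercivity_coefficient_def)
    have "norm (?B y) \<le> inverse \<beta> * norm y" for y
      using coercivity_coefficient_imp_bounded_below[OF \<beta>, of "?B y"] \<beta>0
      by (simp add: AB field_simps)
    then have "?c \<le> inverse \<beta>" using \<beta>0 by (intro onorm_bound) auto
    then show ?thesis using c0 \<beta>0 by (simp add: field_simps)
  qed
  ultimately show ?thesis using coeff lower by (auto simp: coercive_def)
qed

end
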